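(* Let $G$ be a graph and let $P=\{E_i \mid i\in I\}$ be an edge clique partition of $G$. Let $m=m_G(P)$ and $m_v=m_v(P)$ for every $v\in V(G)$. Then: (1) every eigenvalue $\mu$ of $G$ satisfies $\mu\ge -m$; (2) $-m$ is an eigenvalue of $G$ if and only if there exists a vector $X=(x_v)_{v\in V(G)}\neq \mathbf{0}$ such that (a) $\sum_{j\in V(G[E_i])} x_j=0$ for every $i\in I$, and (b) for every $v\in V(G)$, $x_v=0$ whenever $m_v\neq m$. In the positive case, such an $X$ is an eigenvector associated with the eigenvalue $-m$.
   Context: Eigenvalues of a graph are eigenvalues of its adjacency matrix. An edge clique partition (ECP) of $G$ is a partition $P=\{E_i\mid i\in I\}$ of $E(G)$ such that for each $i$, the vertex set $V(G[E_i])$ of the subgraph induced by the edges $E_i$ is a clique of $G$ (i.e. $E_i$ is the full edge set of that clique). For $v\in V(G)$, the clique degree $m_v(P)=|\{i\in I\mid v\in V(G[E_i])\}|$, and the maximum clique degree $m_G(P)=\max\{m_v(P)\mid v\in V(G)\}$. *)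

theory Defs
  imports
    "HOL-Library.Ramsey"
    "HOL-Library.Disjoint_Sets"
    "Jordan_Normal_Form.Char_Poly"
begin

definition simple_graph :: "'a set \<Rightarrow> 'a set set \<Rightarrow> bool" where
  "simple_graph V E \<longleftrightarrow> finite V \<and> E \<subseteq> [V]\<^bsup>2\<^esup>"

(* vs lists the vertices without repetition; it fixes the order of the rows and columns. *)
definition adjacency_matrix :: "'a set set \<Rightarrow> 'a list \<Rightarrow> real mat" where
  "adjacency_matrix E vs =
     mat (length vs) (length vs) (\<lambda>(i, j). if {vs ! i, vs ! j} \<in> E then 1 else 0)"

(* The vector (x_v) in the coordinates given by the enumeration vs. *)
definition vertex_vec :: "'a list \<Rightarrow> ('a \<Rightarrow> real) \<Rightarrow> real vec" where
  "vertex_vec vs x = vec (length vs) (\<lambda>i. x (vs ! i))"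

(* The vertex set of the subgraph induced by a set C of edges is the union of C.
   The clique predicate of Ramsey takes the vertex set first and the edge set second. *)
definition edge_clique_partition ::
    "'a set set \<Rightarrow> 'i set \<Rightarrow> ('i \<Rightarrow> 'a set set) \<Rightarrow> bool" where
  "edge_clique_partition E I P \<longleftrightarrow>
     inj_on P I \<and> partition_on E (P ` I) \<and>
     (\<forall>i\<in>I. clique (\<Union>(P i)) E \<and> P i = {e \<in> E. e \<subseteq> \<Union>(P i)})"

definition clique_degree :: "'i set \<Rightarrow> ('i \<Rightarrow> 'a set set) \<Rightarrow> 'a \<Rightarrow> nat" where
  "clique_degree I P v = card {i \<in> I. v \<in> \<Union>(P i)}"

(* Unspecified when V is empty; the adjacency matrix then has no eigenvalue. *)
definition max_clique_degree :: "'a set \<Rightarrow> 'i set \<Rightarrow> ('i \<Rightarrow> 'a set set) \<Rightarrow> nat" where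
  "max_clique_degree V I P = Max (clique_degree I P ` V)"

end

theory Submission
  imports Defs
begin

text \<open>
  With \<open>S i\<close> the vertex set of the \<open>i\<close>-th clique and \<open>s i\<close> the sum of \<open>x\<close> over \<open>S i\<close>, every
  neighbour of a vertex \<open>v\<close> lies together with \<open>v\<close> in exactly one clique, so the sum of \<open>s i\<close> over
  the cliques through \<open>v\<close> is \<open>m\<^sub>v x\<^sub>v + (A x)\<^sub>v\<close>. This gives the eigenvector claim at once. Pairing
  with \<open>x\<close> yields \<open>\<Sum>\<^sub>i (s i)\<^sup>2 = \<Sum>\<^sub>v m\<^sub>v x\<^sub>v\<^sup>2 + x\<^sup>T A x\<close>; hence, if \<open>A x = \<mu> x\<close>, the sum
  \<open>\<Sum>\<^sub>i (s i)\<^sup>2 + \<Sum>\<^sub>v (m - m\<^sub>v) x\<^sub>v\<^sup>2\<close> of nonnegative terms equals \<open>(\<mu> + m) \<Sum>\<^sub>v x\<^sub>v\<^sup>2\<close>.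
\<close>

section \<open>Simple graphs and the combinatorics of edge clique partitions\<close>

lemma simple_graph_finite_edges: "simple_graph V E \<Longrightarrow> finite E"
  unfolding simple_graph_def by (meson finite_imp_finite_nsets finite_subset)

lemma simple_graph_edgeD:
  assumes "simple_graph V E" "{u, v} \<in> E"
  shows "u \<in> V" "v \<in> V" "u \<noteq> v"
proof -
  have "{u, v} \<subseteq> V" "card {u, v} = 2"
    using assms by (auto simp: simple_graph_def nsets_def)
  then show "u \<in> V" "v \<in> V" "u \<noteq> v"
    by auto
qed

lemma edge_clique_partitionD:
  assumes "edge_clique_partition E I P"
  shows "inj_on P I"
    and "E = (\<Union>i\<in>I. P i)"
    and "i \<in> I \<Longrightarrow> j \<in> I \<Longrightarrow> i \<noteq> j \<Longrightarrow> P i \<inter> P j = {}"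
    and "i \<in> I \<Longrightarrow> clique (\<Union>(P i)) E"
    and "i \<in> I \<Longrightarrow> e \<in> P i \<longleftrightarrow> e \<in> E \<and> e \<subseteq> \<Union>(P i)"
proof -
  have inj: "inj_on P I" and part: "partition_on E (P ` I)"
    and cl: "i \<in> I \<Longrightarrow> clique (\<Union>(P i)) E"
    and full: "i \<in> I \<Longrightarrow> P i = {e \<in> E. e \<subseteq> \<Union>(P i)}"
    using assms unfolding edge_clique_partition_def by (iprover dest: bspec)+
  show "inj_on P I"
    by (fact inj)
  show "E = (\<Union>i\<in>I. P i)"
    using part unfolding partition_on_def by simp
  show "P i \<inter> P j = {}" if "i \<in> I" "j \<in> I" "i \<noteq> j"
  proof (rule disjointD)
    show "disjoint (P ` I)"
      using part by (simp add: partition_on_def)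
    show "P i \<noteq> P j"
      using inj that by (simp add: inj_on_eq_iff)
  qed (use that in simp_all)
  show "clique (\<Union>(P i)) E" if "i \<in> I"
    by (rule cl[OF that])
  show "e \<in> P i \<longleftrightarrow> e \<in> E \<and> e \<subseteq> \<Union>(P i)" if "i \<in> I"
    by (subst full[OF that]) (rule mem_Collect_eq)
qed

text \<open>The parts are subsets of the finite edge set, and \<open>P\<close> is injective on the
  index set.\<close>

lemma ecp_finite_index:
  assumes "simple_graph V E" "edge_clique_partition E I P"
  shows "finite I"
proof -
  have "P ` I \<subseteq> Pow E"
    unfolding edge_clique_partitionD(2)[OF assms(2)] by blast
  then have "finite (P ` I)"
    using simple_graph_finite_edges[OF assms(1)] by (meson finite_Pow_iff finite_subset)
  then show ?thesis
    using edge_clique_partitionD(1)[OF assms(2)] by (rule finite_imageD)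
qed

lemma ecp_clique_subset:
  assumes "simple_graph V E" "edge_clique_partition E I P" "i \<in> I"
  shows "\<Union>(P i) \<subseteq> V"
proof -
  have "\<Union>E \<subseteq> V"
    using assms(1) by (auto simp: simple_graph_def nsets_def)
  moreover have "P i \<subseteq> E"
    unfolding edge_clique_partitionD(2)[OF assms(2)] using assms(3) by blast
  ultimately show ?thesis by blast
qed

text \<open>Two distinct vertices of a clique span an edge, which fullness puts into
  \<open>P i\<close>; conversely an edge has distinct ends. Vertex sums over a clique thus become
  sums over the edges of its part at \<open>v\<close>, where disjointness of the parts
  applies.\<close>

lemma ecp_clique_remove_vertex:
  assumes "simple_graph V E" "edge_clique_partition E I P" "i \<in> I" "v \<in> \<Union>(P i)"
  shows "\<Union>(P i) - {v} = {u. {v, u} \<in> P i}"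
proof (intro equalityI subsetI)
  note P_iff = edge_clique_partitionD(5)[OF assms(2,3)]
  fix u
  show "u \<in> {u. {v, u} \<in> P i}" if u: "u \<in> \<Union>(P i) - {v}"
  proof -
    have "v \<noteq> u" "u \<in> \<Union>(P i)"
      using u by auto
    then have "{v, u} \<in> E" "{v, u} \<subseteq> \<Union>(P i)"
      using edge_clique_partitionD(4)[OF assms(2,3)] assms(4) unfolding clique_def by blast+
    then show ?thesis
      by (simp only: P_iff mem_Collect_eq simp_thms)
  qed
  show "u \<in> \<Union>(P i) - {v}" if u: "u \<in> {u. {v, u} \<in> P i}"
  proof -
    have "{v, u} \<in> E" "{v, u} \<subseteq> \<Union>(P i)"
      using u by (simp_all only: P_iff mem_Collect_eq)
    then show ?thesis
      using simple_graph_edgeD(3)[OF assms(1), of v u] by simp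
  qed
qed

section \<open>Sums of a vertex function over the cliques\<close>

lemma sum_clique_sums_at_vertex:
  fixes x :: "'a \<Rightarrow> real"
  assumes G: "simple_graph V E" and P: "edge_clique_partition E I P"
  shows "(\<Sum>i | i \<in> I \<and> v \<in> \<Union>(P i). \<Sum>j\<in>\<Union>(P i). x j) =
    real (clique_degree I P v) * x v + (\<Sum>u | {v, u} \<in> E. x u)"
proof -
  let ?J = "{i \<in> I. v \<in> \<Union>(P i)}"
  have fin: "finite (\<Union>(P i))" if "i \<in> I" for i
    using ecp_clique_subset[OF G P that] G by (meson finite_subset simple_graph_def)
  \<comment> \<open>Each clique through \<open>v\<close> contributes \<open>x v\<close> once, which
    accounts for the clique degree in the result.\<close>
  have split: "(\<Sum>j\<in>\<Union>(P i). x j) = x v + (\<Sum>u | {v, u} \<in> P i. x u)" if "i \<in> ?J" for i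
    using that sum.remove[OF fin, of i v x] ecp_clique_remove_vertex[OF G P, of i v] by simp
  have "{u. {v, u} \<in> E} = (\<Union>i\<in>?J. {u. {v, u} \<in> P i})"
    using edge_clique_partitionD(2)[OF P] by blast
  moreover have "(\<Sum>u\<in>(\<Union>i\<in>?J. {u. {v, u} \<in> P i}). x u) = (\<Sum>i\<in>?J. \<Sum>u | {v, u} \<in> P i. x u)"
  proof (rule sum.UNION_disjoint)
    show "finite ?J"
      using ecp_finite_index[OF G P] by simp
    show "\<forall>i\<in>?J. finite {u. {v, u} \<in> P i}"
      using fin ecp_clique_remove_vertex[OF G P, of _ v]
      by (metis (no_types, lifting) finite_Diff mem_Collect_eq)
    show "\<forall>i\<in>?J. \<forall>j\<in>?J. i \<noteq> j \<longrightarrow> {u. {v, u} \<in> P i} \<inter> {u. {v, u} \<in> P j} = {}"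
    proof (intro ballI impI)
      fix i j assume "i \<in> ?J" "j \<in> ?J" "i \<noteq> j"
      then have "P i \<inter> P j = {}"
        using edge_clique_partitionD(3)[OF P] by simp
      \<comment> \<open>A common \<open>u\<close> would place the edge \<open>{v, u}\<close> in both
        parts.\<close>
      then show "{u. {v, u} \<in> P i} \<inter> {u. {v, u} \<in> P j} = {}" by blast
    qed
  qed
  ultimately show ?thesis
    using split by (simp add: sum.distrib clique_degree_def)
qed

text \<open>This is the quadratic form of N N^T = D + A, where N is the vertex-clique incidence
  matrix and D the diagonal matrix of clique degrees. One factor of each square is expanded over the
  clique, and the two summations are exchanged.\<close>

lemma sum_squared_clique_sums:
  fixes x :: "'a \<Rightarrow> real"
  assumes G: "simple_graph V E" and P: "edge_clique_partition E I P"
  shows "(\<Sum>i\<in>I. (\<Sum>j\<in>\<Union>(P i). x j)\<^sup>2) =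
    (\<Sum>v\<in>V. real (clique_degree I P v) * (x v)\<^sup>2) + (\<Sum>v\<in>V. x v * (\<Sum>u | {v, u} \<in> E. x u))"
proof -
  define s where "s i = (\<Sum>j\<in>\<Union>(P i). x j)" for i
  have "(\<Sum>i\<in>I. (s i)\<^sup>2) = (\<Sum>i\<in>I. \<Sum>v | v \<in> V \<and> v \<in> \<Union>(P i). x v * s i)"
  proof (rule sum.cong[OF refl])
    fix i assume "i \<in> I"
    then have "{v. v \<in> V \<and> v \<in> \<Union>(P i)} = \<Union>(P i)"
      using ecp_clique_subset[OF G P] by blast
    then show "(s i)\<^sup>2 = (\<Sum>v | v \<in> V \<and> v \<in> \<Union>(P i). x v * s i)"
      by (simp add: power2_eq_square flip: sum_distrib_right s_def)
  qed
  also have "\<dots> = (\<Sum>v\<in>V. \<Sum>i | i \<in> I \<and> v \<in> \<Union>(P i). x v * s i)"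
    using G by (intro sum.swap_restrict ecp_finite_index[OF G P]) (simp add: simple_graph_def)
  also have "\<dots> = (\<Sum>v\<in>V. x v * (real (clique_degree I P v) * x v + (\<Sum>u | {v, u} \<in> E. x u)))"
    unfolding s_def by (simp only: sum_clique_sums_at_vertex[OF G P] flip: sum_distrib_left)
  finally show ?thesis
    by (simp add: s_def power2_eq_square algebra_simps sum.distrib)
qed

lemma clique_degree_le_max:
  assumes "finite V" "v \<in> V"
  shows "clique_degree I P v \<le> max_clique_degree V I P"
  using assms by (simp add: max_clique_degree_def)

section \<open>The adjacency matrix as an operator on vertex functions\<close>

lemma adjacency_matrix_mult_vertex_vec:
  assumes "simple_graph V E" "distinct vs" "set vs = V"
  shows "adjacency_matrix E vs *\<^sub>v vertex_vec vs x = vertex_vec vs (\<lambda>v. \<Sum>u | {v, u} \<in> E. x u)"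
proof (rule eq_vecI)
  show "dim_vec (adjacency_matrix E vs *\<^sub>v vertex_vec vs x) =
      dim_vec (vertex_vec vs (\<lambda>v. \<Sum>u | {v, u} \<in> E. x u))"
    by (simp add: adjacency_matrix_def vertex_vec_def)
next
  fix i assume "i < dim_vec (vertex_vec vs (\<lambda>v. \<Sum>u | {v, u} \<in> E. x u))"
  then have i: "i < length vs" by (simp add: vertex_vec_def)
  let ?f = "\<lambda>u. if {vs ! i, u} \<in> E then x u else 0"
  have "(adjacency_matrix E vs *\<^sub>v vertex_vec vs x) $ i = (\<Sum>j<length vs. ?f (vs ! j))"
    using i by (auto simp: adjacency_matrix_def vertex_vec_def scalar_prod_def lessThan_atLeast0
        intro!: sum.cong)
  also have "\<dots> = sum ?f V"
    \<comment> \<open>Since \<open>vs\<close> is distinct, positions in the list correspond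
      bijectively to vertices.\<close>
    using sum.reindex_bij_betw[OF bij_betw_nth[OF assms(2) refl assms(3)[symmetric]]] .
  also have "\<dots> = (\<Sum>u | u \<in> V \<and> {vs ! i, u} \<in> E. x u)"
    using assms(1) by (simp add: sum.inter_filter simple_graph_def)
  also have "{u. u \<in> V \<and> {vs ! i, u} \<in> E} = {u. {vs ! i, u} \<in> E}"
    using simple_graph_edgeD(2)[OF assms(1)] by blast
  finally show "(adjacency_matrix E vs *\<^sub>v vertex_vec vs x) $ i =
      vertex_vec vs (\<lambda>v. \<Sum>u | {v, u} \<in> E. x u) $ i"
    using i by (simp add: vertex_vec_def)
qed

lemma vertex_vec_eq_iff: "vertex_vec vs x = vertex_vec vs y \<longleftrightarrow> (\<forall>v\<in>set vs. x v = y v)"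
  by (auto simp: vertex_vec_def vec_eq_iff all_set_conv_all_nth)

text \<open>Removes the enumeration \<open>vs\<close> from the eigenvector equation. The quantifiers
  range over \<open>V\<close> only, because \<open>vertex_vec\<close> records just the values
  there.\<close>

lemma eigenvector_vertex_vec_iff:
  assumes "simple_graph V E" "distinct vs" "set vs = V"
  shows "eigenvector (adjacency_matrix E vs) (vertex_vec vs x) \<mu> \<longleftrightarrow>
    (\<exists>v\<in>V. x v \<noteq> 0) \<and> (\<forall>v\<in>V. (\<Sum>u | {v, u} \<in> E. x u) = \<mu> * x v)"
proof -
  have "0\<^sub>v (length vs) = vertex_vec vs (\<lambda>_. 0)" "\<mu> \<cdot>\<^sub>v vertex_vec vs x = vertex_vec vs (\<lambda>v. \<mu> * x v)"
    by (auto simp: vertex_vec_def)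
  moreover have "dim_row (adjacency_matrix E vs) = length vs" "dim_vec (vertex_vec vs x) = length vs"
    by (simp_all add: adjacency_matrix_def vertex_vec_def)
  ultimately show ?thesis
    by (simp only: eigenvector_def carrier_vec_def mem_Collect_eq simp_thms ball_simps
        adjacency_matrix_mult_vertex_vec[OF assms] vertex_vec_eq_iff assms(3))
qed

lemma vertex_vec_surj:
  assumes "distinct vs" "w \<in> carrier_vec (length vs)"
  obtains x where "w = vertex_vec vs x"
proof
  have "inj_on ((!) vs) {..<length vs}"
    using assms(1) by (auto simp: inj_on_def nth_eq_iff_index_eq)
  \<comment> \<open>The witness sends a vertex to the coordinate of \<open>w\<close> at its position
    in \<open>vs\<close>.\<close>
  then show "w = vertex_vec vs (\<lambda>v. w $ inv_into {..<length vs} ((!) vs) v)"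
    using assms(2) by (intro eq_vecI) (auto simp: vertex_vec_def)
qed

lemma eigenvalue_adjacency_matrix_iff:
  assumes "simple_graph V E" "distinct vs" "set vs = V"
  shows "eigenvalue (adjacency_matrix E vs) \<mu> \<longleftrightarrow>
    (\<exists>x. (\<exists>v\<in>V. x v \<noteq> 0) \<and> (\<forall>v\<in>V. (\<Sum>u | {v, u} \<in> E. x u) = \<mu> * x v))"
proof
  assume "eigenvalue (adjacency_matrix E vs) \<mu>"
  then obtain w where w: "eigenvector (adjacency_matrix E vs) w \<mu>"
    by (auto simp: eigenvalue_def)
  then have "w \<in> carrier_vec (length vs)"
    by (simp add: eigenvector_def adjacency_matrix_def)
  then obtain x where "w = vertex_vec vs x"
    using vertex_vec_surj[OF assms(2)] by blast
  with w show "\<exists>x. (\<exists>v\<in>V. x v \<noteq> 0) \<and> (\<forall>v\<in>V. (\<Sum>u | {v, u} \<in> E. x u) = \<mu> * x v)"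
    using eigenvector_vertex_vec_iff[OF assms] by blast
next
  assume "\<exists>x. (\<exists>v\<in>V. x v \<noteq> 0) \<and> (\<forall>v\<in>V. (\<Sum>u | {v, u} \<in> E. x u) = \<mu> * x v)"
  then show "eigenvalue (adjacency_matrix E vs) \<mu>"
    using eigenvector_vertex_vec_iff[OF assms] by (auto simp: eigenvalue_def)
qed

text \<open>The constant \<open>c\<close> shifts the quadratic form; once it is at least every
  clique degree, all terms on the left are nonnegative.\<close>

lemma eigenvector_squares_identity:
  fixes x :: "'a \<Rightarrow> real"
  assumes "simple_graph V E" "edge_clique_partition E I P"
    and "\<forall>v\<in>V. (\<Sum>u | {v, u} \<in> E. x u) = \<mu> * x v"
  shows "(\<Sum>i\<in>I. (\<Sum>j\<in>\<Union>(P i). x j)\<^sup>2) + (\<Sum>v\<in>V. (c - real (clique_degree I P v)) * (x v)\<^sup>2) =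
    (\<mu> + c) * (\<Sum>v\<in>V. (x v)\<^sup>2)"
proof -
  have "(\<Sum>v\<in>V. x v * (\<Sum>u | {v, u} \<in> E. x u)) = \<mu> * (\<Sum>v\<in>V. (x v)\<^sup>2)"
    using assms(3) by (simp add: sum_distrib_left power2_eq_square algebra_simps)
  then show ?thesis
    using sum_squared_clique_sums[OF assms(1,2), of x]
    by (simp add: left_diff_distrib distrib_right sum_subtractf flip: sum_distrib_left)
qed

section \<open>The lower bound on eigenvalues and its equality case\<close>

theorem theorem7:
  fixes V :: "'a set" and E :: "'a set set" and vs :: "'a list"
    and I :: "'i set" and P :: "'i \<Rightarrow> 'a set set" and m :: nat
  assumes "simple_graph V E"
    and "distinct vs" and "set vs = V"
    and "edge_clique_partition E I P"
    and "m = max_clique_degree V I P"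
  shows "(\<forall>\<mu>. eigenvalue (adjacency_matrix E vs) \<mu> \<longrightarrow> \<mu> \<ge> - real m) \<and>
    (eigenvalue (adjacency_matrix E vs) (- real m) \<longleftrightarrow>
      (\<exists>x :: 'a \<Rightarrow> real. (\<exists>v\<in>V. x v \<noteq> 0) \<and>
         (\<forall>i\<in>I. (\<Sum>j\<in>\<Union>(P i). x j) = 0) \<and>
         (\<forall>v\<in>V. clique_degree I P v \<noteq> m \<longrightarrow> x v = 0))) \<and>
    (\<forall>x :: 'a \<Rightarrow> real. (\<exists>v\<in>V. x v \<noteq> 0) \<and>
         (\<forall>i\<in>I. (\<Sum>j\<in>\<Union>(P i). x j) = 0) \<and>
         (\<forall>v\<in>V. clique_degree I P v \<noteq> m \<longrightarrow> x v = 0) \<longrightarrow>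
         eigenvector (adjacency_matrix E vs) (vertex_vec vs x) (- real m))"
proof -
  note G = assms(1) and P = assms(4)
  have finV: "finite V" and finI: "finite I"
    using G ecp_finite_index[OF G P] by (auto simp: simple_graph_def)
  \<comment> \<open>A vertex makes \<open>V\<close> nonempty, so \<open>m\<close> is a genuine
    maximum here.\<close>
  have deg: "clique_degree I P v \<le> m" if "v \<in> V" for v
    using clique_degree_le_max[OF finV that] assms(5) by simp
  let ?cond = "\<lambda>x :: 'a \<Rightarrow> real. (\<exists>v\<in>V. x v \<noteq> 0) \<and> (\<forall>i\<in>I. (\<Sum>j\<in>\<Union>(P i). x j) = 0) \<and>
    (\<forall>v\<in>V. clique_degree I P v \<noteq> m \<longrightarrow> x v = 0)"
  define s where "s x i = (\<Sum>j\<in>\<Union>(P i). x j)" for x :: "'a \<Rightarrow> real" and i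
  define d where "d x v = (real m - real (clique_degree I P v)) * (x v)\<^sup>2" for x :: "'a \<Rightarrow> real" and v
  have d_nonneg: "d x v \<ge> 0" if "v \<in> V" for x v
    using deg[OF that] by (simp add: d_def)
  have key: "(\<Sum>i\<in>I. (s x i)\<^sup>2) + sum (d x) V = (\<mu> + real m) * (\<Sum>v\<in>V. (x v)\<^sup>2)"
    if "\<forall>v\<in>V. (\<Sum>u | {v, u} \<in> E. x u) = \<mu> * x v" for x \<mu>
    using eigenvector_squares_identity[OF G P that] by (simp add: s_def d_def)
  have lower: "\<mu> \<ge> - real m" if ev: "eigenvalue (adjacency_matrix E vs) \<mu>" for \<mu>
  proof -
    obtain x v where v: "v \<in> V" "x v \<noteq> 0" and eq: "\<forall>v\<in>V. (\<Sum>u | {v, u} \<in> E. x u) = \<mu> * x v"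
      using ev unfolding eigenvalue_adjacency_matrix_iff[OF assms(1-3)] by blast
    \<comment> \<open>A positive factor, so the sign of the product in \<open>key\<close> decides
      the sign of \<open>\<mu> + real m\<close>.\<close>
    have "(\<Sum>v\<in>V. (x v)\<^sup>2) > 0"
      using v finV by (intro sum_pos2[of _ v]) auto
    moreover have "(\<mu> + real m) * (\<Sum>v\<in>V. (x v)\<^sup>2) \<ge> 0"
      unfolding key[OF eq, symmetric] using d_nonneg by (intro add_nonneg_nonneg sum_nonneg) auto
    ultimately show ?thesis
      by (simp add: zero_le_mult_iff)
  qed
  have vec: "eigenvector (adjacency_matrix E vs) (vertex_vec vs x) (- real m)" if x: "?cond x" for x
    unfolding eigenvector_vertex_vec_iff[OF assms(1-3)]
  proof (intro conjI ballI)
    show "\<exists>v\<in>V. x v \<noteq> 0" using x by blast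
    fix v assume v: "v \<in> V"
    have "(\<Sum>i | i \<in> I \<and> v \<in> \<Union>(P i). \<Sum>j\<in>\<Union>(P i). x j) = 0"
      using x by (intro sum.neutral) blast
    then have "(\<Sum>u | {v, u} \<in> E. x u) = - real (clique_degree I P v) * x v"
      using sum_clique_sums_at_vertex[OF G P, of x v] by linarith
    \<comment> \<open>If the clique degree differs from \<open>m\<close>, then
      \<open>x v = 0\<close> and both coefficients give zero.\<close>
    then show "(\<Sum>u | {v, u} \<in> E. x u) = - real m * x v"
      using x v by (cases "clique_degree I P v = m") auto
  qed
  have cond: "\<exists>x. ?cond x" if ev: "eigenvalue (adjacency_matrix E vs) (- real m)"
  proof -
    obtain x where nz: "\<exists>v\<in>V. x v \<noteq> 0"
      and eq: "\<forall>v\<in>V. (\<Sum>u | {v, u} \<in> E. x u) = - real m * x v"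
      using ev unfolding eigenvalue_adjacency_matrix_iff[OF assms(1-3)] by blast
    have "(\<Sum>i\<in>I. (s x i)\<^sup>2) \<ge> 0" "sum (d x) V \<ge> 0"
      using d_nonneg by (auto intro: sum_nonneg)
    \<comment> \<open>At \<open>\<mu> = - real m\<close> the right side of \<open>key\<close>
      vanishes, forcing both nonnegative sums to vanish, and then each of their terms.\<close>
    then have "(\<Sum>i\<in>I. (s x i)\<^sup>2) = 0" "sum (d x) V = 0"
      using key[OF eq] by simp_all
    then have "\<forall>i\<in>I. s x i = 0" "\<forall>v\<in>V. d x v = 0"
      using finI finV d_nonneg by (simp_all add: sum_nonneg_eq_0_iff)
    \<comment> \<open>\<open>d x v = 0\<close> says that the clique degree of \<open>v\<close> is
      \<open>m\<close> or \<open>x v = 0\<close>, which is the support condition.\<close>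
    then have "?cond x"
      using nz by (auto simp: s_def d_def)
    then show ?thesis by blast
  qed
  have "eigenvalue (adjacency_matrix E vs) (- real m)" if "?cond x" for x
    unfolding eigenvalue_def using vec[OF that] by (rule exI)
  with cond have "eigenvalue (adjacency_matrix E vs) (- real m) \<longleftrightarrow> (\<exists>x. ?cond x)"
    by (intro iffI) (assumption | erule exE)+
  then show ?thesis
    by (intro conjI allI impI) (assumption | erule lower vec)+
qed

end
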